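(* Let $n\ge 1$, $s>0$ and $\lambda>1$. Then, as $r:=|x|\to\infty$, the logarithmic Bessel kernel $K_{s+\ln}^{\lambda}(x)$ satisfies $$\lim_{r\to\infty}\Bigl(r^{\frac{n-1}{2}}e^{\sqrt{\lambda-1}\,r}\Bigr)\,K_{s+\ln}^{\lambda}(x)=\frac{(\lambda-1)^{\frac{n-3}{4}}}{2^{\frac{n+1}{2}}\pi^{\frac{n-1}{2}}}.$$
   Context: The Fourier transform on $\mathbb{R}^n$ is $\widehat f(\xi)=\int_{\mathbb{R}^n}f(x)e^{-2\pi i x\cdot\xi}\,dx$, extended to tempered distributions. For $s>0$, $\lambda>1$, the logarithmic Bessel kernel $K_{s+\ln}^{\lambda}$ is the tempered distribution whose Fourier transform is $\dfrac{1}{(\lambda+4\pi^2|\xi|^2)^s\,\ln(\lambda+4\pi^2|\xi|^2)}$. It is an $L^1(\mathbb R^n)$ function, and its pointwise values for $x\ne0$ are those of the (radial) representative $$K_{s+\ln}^{\lambda}(x)=\int_s^\infty \frac{1}{\Gamma(\alpha)}\int_0^\infty e^{-\lambda t}\,t^{\alpha-1}\,p_t(x)\,dt\,d\alpha,\qquad p_t(x)=(4\pi t)^{-n/2}e^{-|x|^2/(4t)}.$$ *)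

theory Defs
  imports "HOL-Probability.Probability"
begin

definition heat_kernel :: "real \<Rightarrow> 'a::euclidean_space \<Rightarrow> real" where
  "heat_kernel t x = (4 * pi * t) powr (- (real DIM('a) / 2)) * exp (- (norm x)\<^sup>2 / (4 * t))"

(* For x = 0 the integrals may diverge, and then the Lebesgue integral takes a default value. *)
definition log_bessel_kernel :: "real \<Rightarrow> real \<Rightarrow> 'a::euclidean_space \<Rightarrow> real" where
  "log_bessel_kernel s lam x =
     (LINT \<alpha>:{s..}|lborel. 1 / Gamma \<alpha> *
        (LINT t:{0<..}|lborel. exp (- lam * t) * t powr (\<alpha> - 1) * heat_kernel t x))"

definition fourier_transform :: "('a::euclidean_space \<Rightarrow> real) \<Rightarrow> 'a \<Rightarrow> complex" where
  "fourier_transform f \<xi> = (LINT x|lborel. complex_of_real (f x) * exp (- 2 * pi * \<i> * (x \<bullet> \<xi>)))"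

lemma fourier_cis: "exp (- 2 * pi * \<i> * complex_of_real y) = cis (- (2 * pi * y))"
  by (simp add: cis_conv_exp mult_ac)

lemma fourier_fubini:
  fixes f :: "real \<Rightarrow> 'a::euclidean_space \<Rightarrow> real"
  assumes [measurable]: "(\<lambda>(a, x). f a x) \<in> borel_measurable (lborel \<Otimes>\<^sub>M lborel)"
    and nonneg: "\<And>a x. f a x \<ge> 0"
    and int1: "\<And>a. integrable lborel (f a)"
    and int2: "integrable lborel (\<lambda>a. LINT x|lborel. f a x)"
  shows "integrable lborel (\<lambda>x. LINT a|lborel. f a x)"
    and "fourier_transform (\<lambda>x. LINT a|lborel. f a x) \<xi> = (LINT a|lborel. fourier_transform (f a) \<xi>)"
proof -
  have P: "pair_sigma_finite (lborel :: real measure) (lborel :: 'a measure)"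
    by (intro pair_sigma_finite.intro sigma_finite_lborel)
  have m[measurable]: "case_prod f \<in> borel_measurable (borel \<Otimes>\<^sub>M borel)"
    using assms(1) by (simp cong: measurable_cong_sets sets_pair_measure_cong)
  have I: "integrable (lborel \<Otimes>\<^sub>M lborel) (\<lambda>(a, x). f a x)"
    by (rule pair_sigma_finite.Fubini_integrable[OF P]) (use nonneg int1 int2 in auto)
  show "integrable lborel (\<lambda>x. LINT a|lborel. f a x)"
    using pair_sigma_finite.integrable_snd[OF P I] by simp
  let ?h = "\<lambda>(a, x). complex_of_real (f a x) * cis (- (2 * pi * (x \<bullet> \<xi>)))"
  have "integrable (lborel \<Otimes>\<^sub>M lborel) ?h"
  proof (rule pair_sigma_finite.Fubini_integrable[OF P])
    show "?h \<in> borel_measurable (lborel \<Otimes>\<^sub>M lborel)"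
      unfolding cis_conv_exp by measurable
    show "integrable lborel (\<lambda>a. LINT x|lborel. norm (?h (a, x)))"
      using nonneg int2 by (simp add: norm_mult)
    show "AE a in lborel. integrable lborel (\<lambda>x. ?h (a, x))"
    proof (rule AE_I2)
      fix a :: real
      have "(\<lambda>x. cis (- (2 * pi * (x \<bullet> \<xi>)))) \<in> borel_measurable lborel"
        unfolding cis_conv_exp by measurable
      then show "integrable lborel (\<lambda>x. ?h (a, x))"
        using borel_measurable_integrable[OF int1[of a]]
        by (intro Bochner_Integration.integrable_bound[OF int1[of a]])
           (auto simp: norm_mult nonneg)
    qed
  qed
  from pair_sigma_finite.Fubini_integral[OF P this]
  show "fourier_transform (\<lambda>x. LINT a|lborel. f a x) \<xi> = (LINT a|lborel. fourier_transform (f a) \<xi>)"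
    unfolding fourier_transform_def fourier_cis by (simp flip: integral_complex_of_real)
qed

lemma fourier_gauss_1:
  fixes t \<eta> :: real
  assumes t: "t > 0"
  defines "g \<equiv> (\<lambda>y. (4 * pi * t) powr (- (1/2)) * exp (- y\<^sup>2 / (4 * t)))"
  shows "integrable lborel (\<lambda>y. complex_of_real (g y) * cis (- (2 * pi * (y * \<eta>))))"
    and "(LINT y|lborel. complex_of_real (g y) * cis (- (2 * pi * (y * \<eta>)))) =
           complex_of_real (exp (- (4 * pi\<^sup>2 * \<eta>\<^sup>2 * t)))"
proof -
  define c where "c = sqrt (2 * t)"
  have c: "c > 0" "c\<^sup>2 = 2 * t" using t by (auto simp: c_def)
  have g: "g (0 + c * y) = std_normal_density y / c" for y
  proof -
    have "(4 * pi * t) powr (- (1/2)) = 1 / (sqrt (2 * pi) * c)"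
      using t by (simp add: powr_minus powr_half_sqrt c_def real_sqrt_mult field_simps)
    moreover have "(c * y)\<^sup>2 / (4 * t) = y\<^sup>2 / 2"
      using t by (simp add: power_mult_distrib c(2))
    ultimately show ?thesis
      by (simp add: g_def std_normal_density_def)
  qed
  have gint: "integrable lborel g"
  proof -
    have "integrable lborel (\<lambda>y. g (0 + c * y))"
      unfolding g using integrable_normal_density[of 1 0] by simp
    then show ?thesis
      using c lborel_integrable_real_affine_iff[of c g 0] by simp
  qed
  have "(\<lambda>y. cis (- (2 * pi * (y * \<eta>)))) \<in> borel_measurable lborel"
    unfolding cis_conv_exp by measurable
  then show I: "integrable lborel (\<lambda>y. complex_of_real (g y) * cis (- (2 * pi * (y * \<eta>))))"
    using borel_measurable_integrable[OF gint]
    by (intro Bochner_Integration.integrable_bound[OF gint]) (auto simp: norm_mult)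
  let ?u = "- (2 * pi * c * \<eta>)"
  have "(LINT y|lborel. complex_of_real (g y) * cis (- (2 * pi * (y * \<eta>)))) =
        c *\<^sub>R (LINT y|lborel. complex_of_real (std_normal_density y / c) * cis (- (2 * pi * ((c * y) * \<eta>))))"
    using c g by (subst lborel_integral_real_affine[of c _ 0]) auto
  also have "\<dots> = (LINT y|lborel. c *\<^sub>R (complex_of_real (std_normal_density y / c) * cis (- (2 * pi * ((c * y) * \<eta>)))))"
    by simp
  also have "\<dots> = (LINT y|lborel. std_normal_density y *\<^sub>R iexp (?u * y))"
    using c by (intro Bochner_Integration.integral_cong)
      (auto simp: cis_conv_exp scaleR_conv_of_real mult_ac)
  also have "\<dots> = char std_normal_distribution ?u"
    unfolding char_def by (subst integral_density) auto
  also have "\<dots> = complex_of_real (exp (- (?u\<^sup>2) / 2))"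
    by (simp add: char_std_normal_distribution)
  also have "?u\<^sup>2 = 8 * pi\<^sup>2 * \<eta>\<^sup>2 * t"
    by (simp add: power_mult_distrib c(2))
  finally show "(LINT y|lborel. complex_of_real (g y) * cis (- (2 * pi * (y * \<eta>)))) =
           complex_of_real (exp (- (4 * pi\<^sup>2 * \<eta>\<^sup>2 * t)))"
    by simp
qed

lemma cis_sum: "finite A \<Longrightarrow> cis (sum f A) = (\<Prod>i\<in>A. cis (f i))"
  by (induction A rule: finite_induct) (auto simp flip: cis_mult)

lemma fourier_heat_kernel:
  fixes \<xi> :: "'a::euclidean_space"
  assumes t: "t > 0"
  shows "integrable lborel (\<lambda>x. complex_of_real (heat_kernel t x) * cis (- (2 * pi * (x \<bullet> \<xi>))))"
    and "fourier_transform (heat_kernel t) \<xi> = complex_of_real (exp (- (4 * pi\<^sup>2 * (norm \<xi>)\<^sup>2 * t)))"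
proof -
  let ?g = "\<lambda>y. (4 * pi * t) powr (- (1/2)) * exp (- y\<^sup>2 / (4 * t))"
  define h where "h = (\<lambda>b y. complex_of_real (?g y) * cis (- (2 * pi * (y * (\<xi> \<bullet> b)))))"
  have sq: "(norm x)\<^sup>2 = (\<Sum>b\<in>Basis. (x \<bullet> b)\<^sup>2)" for x :: 'a
    unfolding power2_norm_eq_inner by (subst euclidean_inner) (simp add: power2_eq_square)
  have heat: "heat_kernel t x = (\<Prod>b\<in>Basis. ?g (x \<bullet> b))" for x :: 'a
  proof -
    have "(4 * pi * t) powr (- (real DIM('a) / 2)) = (\<Prod>b\<in>(Basis::'a set). (4 * pi * t) powr (- (1/2)))"
      using t by (simp add: powr_powr flip: powr_realpow)
    moreover have "exp (- (norm x)\<^sup>2 / (4 * t)) = (\<Prod>b\<in>Basis. exp (- (x \<bullet> b)\<^sup>2 / (4 * t)))"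
      unfolding sq by (simp add: exp_sum[symmetric] sum_negf sum_divide_distrib)
    ultimately show ?thesis
      by (simp only: h_def heat_kernel_def prod.distrib)
  qed
  have eq: "complex_of_real (heat_kernel t x) * cis (- (2 * pi * (x \<bullet> \<xi>))) = (\<Prod>b\<in>Basis. h b (x \<bullet> b))"
    for x :: 'a
  proof -
    have "- (2 * pi * (x \<bullet> \<xi>)) = (\<Sum>b\<in>Basis. - (2 * pi * ((x \<bullet> b) * (\<xi> \<bullet> b))))"
      by (subst euclidean_inner) (simp add: sum_negf sum_distrib_left)
    then show ?thesis
      by (simp only: h_def heat cis_sum[OF finite_Basis] prod.distrib of_real_prod of_real_mult)
  qed
  interpret product_sigma_finite "\<lambda>b::'a. lborel :: real measure"
    by standard
  have h: "h b \<in> borel_measurable borel" for b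
    unfolding h_def cis_conv_exp by measurable
  have int: "integrable (\<Pi>\<^sub>M b\<in>Basis. lborel) (\<lambda>x. \<Prod>b\<in>Basis. h b (x b))"
    unfolding h_def by (intro product_integrable_prod fourier_gauss_1(1) t) auto
  have *: "(\<Prod>b\<in>Basis. h b ((\<Sum>b\<in>Basis. x b *\<^sub>R b) \<bullet> b)) = (\<Prod>b\<in>Basis. h b (x b))" for x :: "'a \<Rightarrow> real"
    by (intro prod.cong) (auto simp: inner_sum_left inner_Basis if_distrib cong: if_cong)
  have T: "(\<lambda>x. \<Sum>b\<in>Basis. x b *\<^sub>R b) \<in> (\<Pi>\<^sub>M b\<in>(Basis::'a set). lborel) \<rightarrow>\<^sub>M borel"
    by measurable
  have H: "(\<lambda>x::'a. \<Prod>b\<in>Basis. h b (x \<bullet> b)) \<in> borel_measurable borel"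
    by (intro borel_measurable_prod measurable_compose[OF _ h]) simp
  show "integrable lborel (\<lambda>x::'a. complex_of_real (heat_kernel t x) * cis (- (2 * pi * (x \<bullet> \<xi>))))"
    unfolding eq by (subst lborel_eq, subst integrable_distr_eq[OF T H]) (simp only: * int)
  have "fourier_transform (heat_kernel t) \<xi> = (LINT x|lborel. (\<Prod>b\<in>Basis. h b (x \<bullet> b)))"
    by (simp only: fourier_transform_def fourier_cis eq)
  also have "\<dots> = (LINT x|(\<Pi>\<^sub>M b\<in>(Basis::'a set). lborel). (\<Prod>b\<in>Basis. h b (x b)))"
    by (subst lborel_eq, subst integral_distr[OF T H]) (simp only: *)
  also have "\<dots> = (\<Prod>b\<in>(Basis::'a set). LINT y|lborel. h b y)"
    unfolding h_def by (intro product_integral_prod fourier_gauss_1(1) t) auto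
  also have "\<dots> = (\<Prod>b\<in>(Basis::'a set). complex_of_real (exp (- (4 * pi\<^sup>2 * (\<xi> \<bullet> b)\<^sup>2 * t))))"
    by (simp only: h_def fourier_gauss_1(2)[OF t])
  also have "\<dots> = complex_of_real (exp (- (4 * pi\<^sup>2 * (norm \<xi>)\<^sup>2 * t)))"
    by (simp only: of_real_prod[symmetric] exp_sum[OF finite_Basis, symmetric] sq)
       (simp add: sum_negf sum_distrib_left sum_distrib_right)
  finally show "fourier_transform (heat_kernel t) \<xi> = complex_of_real (exp (- (4 * pi\<^sup>2 * (norm \<xi>)\<^sup>2 * t)))" .
qed

lemma fourier_transform_0: "fourier_transform f 0 = complex_of_real (LINT x|lborel. f x)"
  by (simp add: fourier_transform_def)

lemma integrable_heat_kernel: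
  assumes "t > 0"
  shows "integrable lborel (heat_kernel t :: 'a::euclidean_space \<Rightarrow> real)"
  using fourier_heat_kernel(1)[OF assms, of "0::'a"] by (simp add: complex_of_real_integrable_eq)

lemma gamma_integral:
  fixes c \<alpha> :: real
  assumes c: "c > 0" and \<alpha>: "\<alpha> > 0"
  shows "has_bochner_integral lborel (\<lambda>t. indicator {0<..} t * (exp (- c * t) * t powr (\<alpha> - 1)))
           (Gamma \<alpha> * c powr - \<alpha>)"
proof -
  let ?f = "\<lambda>t. indicator {0<..} t * (exp (- c * t) * t powr (\<alpha> - 1))"
  have "ennreal (Gamma \<alpha>) = (\<integral>\<^sup>+t. ennreal (indicator {0..} t * t powr (\<alpha> - 1) / exp t) \<partial>lborel)"
    by (rule Gamma_conv_nn_integral_real[OF \<alpha>])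
  also have "\<dots> = ennreal \<bar>c\<bar> * (\<integral>\<^sup>+t. ennreal (indicator {0..} (0 + c * t) * (0 + c * t) powr (\<alpha> - 1) / exp (0 + c * t)) \<partial>lborel)"
    using c by (subst nn_integral_real_affine[of _ c 0]) auto
  also have "\<dots> = (\<integral>\<^sup>+t. ennreal (c powr \<alpha>) * ennreal (?f t) \<partial>lborel)"
    using c
    by (subst nn_integral_cmult[symmetric])
       (auto intro!: nn_integral_cong simp: ennreal_mult'[symmetric] indicator_def powr_mult exp_minus
          field_simps powr_diff zero_le_mult_iff)
  also have "\<dots> = ennreal (c powr \<alpha>) * (\<integral>\<^sup>+t. ennreal (?f t) \<partial>lborel)"
    by (subst nn_integral_cmult) auto
  finally have e: "ennreal (Gamma \<alpha>) = ennreal (c powr \<alpha>) * (\<integral>\<^sup>+t. ennreal (?f t) \<partial>lborel)" .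
  have "(\<integral>\<^sup>+t. ennreal (?f t) \<partial>lborel) = ennreal (c powr - \<alpha>) * (ennreal (c powr \<alpha>) * (\<integral>\<^sup>+t. ennreal (?f t) \<partial>lborel))"
  proof -
    have "c powr - \<alpha> * c powr \<alpha> = 1"
      using c by (simp flip: powr_add)
    then have "ennreal (c powr - \<alpha>) * ennreal (c powr \<alpha>) = 1"
      by (simp flip: ennreal_mult')
    then show ?thesis
      by (simp flip: mult.assoc)
  qed
  also have "\<dots> = ennreal (Gamma \<alpha> * c powr - \<alpha>)"
    unfolding e[symmetric] using Gamma_real_pos[OF \<alpha>] by (simp add: ennreal_mult'[symmetric] mult.commute)
  finally show ?thesis
    using Gamma_real_pos[OF \<alpha>] by (intro has_bochner_integral_nn_integral) auto
qed

lemma powr_integral: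
  fixes c s :: real
  assumes c: "c > 1"
  shows "has_bochner_integral lborel (\<lambda>\<alpha>. indicator {s..} \<alpha> * c powr - \<alpha>) (c powr - s / ln c)"
proof -
  have "((\<lambda>\<alpha>. exp (- ln c * \<alpha>)) has_integral (exp (- ln c * s) / ln c)) {s..}"
    using c by (intro has_integral_exp_minus_to_infinity) auto
  from nn_integral_has_integral_lebesgue[OF _ this]
  have "(\<integral>\<^sup>+\<alpha>. ennreal (indicator {s..} \<alpha> * exp (- ln c * \<alpha>)) \<partial>lborel) = ennreal (exp (- ln c * s) / ln c)"
    by auto
  then show ?thesis
    using c by (intro has_bochner_integral_nn_integral) (auto simp: powr_def mult.commute)
qed

(* The pointwise formula defines an L1 function whose Fourier transform is the defining symbol
   of the logarithmic Bessel kernel. *)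
theorem
  fixes \<xi> :: "'a::euclidean_space"
  assumes s: "s > 0" and l: "lam > 1"
  shows integrable_log_bessel_kernel:
      "integrable lborel (log_bessel_kernel s lam :: 'a \<Rightarrow> real)"
    and fourier_log_bessel_kernel:
      "fourier_transform (log_bessel_kernel s lam) \<xi> =
         complex_of_real (1 / ((lam + 4 * pi\<^sup>2 * (norm \<xi>)\<^sup>2) powr s * ln (lam + 4 * pi\<^sup>2 * (norm \<xi>)\<^sup>2)))"
proof -
  define f where "f = (\<lambda>\<alpha> t (x::'a). indicator {0<..} t * (exp (- lam * t) * t powr (\<alpha> - 1) * heat_kernel t x))"
  define G where "G = (\<lambda>\<alpha> (x::'a). indicator {s..} \<alpha> * (rGamma \<alpha> * (LINT t|lborel. f \<alpha> t x)))"
  have K: "log_bessel_kernel s lam = (\<lambda>x::'a. LINT \<alpha>|lborel. G \<alpha> x)"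
    unfolding log_bessel_kernel_def set_lebesgue_integral_def G_def f_def
    by (auto simp: rGamma_inverse_Gamma field_simps)
  have c: "lam + 4 * pi\<^sup>2 * (norm \<zeta>)\<^sup>2 > 1" for \<zeta> :: 'a
    using l by (smt (verit) zero_le_mult_iff zero_le_power2)
  have heat_m[measurable]: "(\<lambda>(t, x::'a). heat_kernel t x) \<in> borel_measurable (borel \<Otimes>\<^sub>M borel)"
    unfolding heat_kernel_def by measurable
  have f_m[measurable]: "(\<lambda>p. f (fst p) (fst (snd p)) (snd (snd p))) \<in> borel_measurable (borel \<Otimes>\<^sub>M borel \<Otimes>\<^sub>M borel)"
    unfolding f_def by measurable
  have f_nn: "f \<alpha> t x \<ge> 0" for \<alpha> t x
    by (auto simp: f_def heat_kernel_def)
  have rG[measurable]: "(rGamma :: real \<Rightarrow> real) \<in> borel_measurable borel"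
    by (intro borel_measurable_continuous_onI continuous_on_rGamma)
  have int_f: "integrable lborel (f \<alpha> t)" for \<alpha> t
    by (cases "t > 0") (auto simp: f_def intro!: integrable_mult_right integrable_heat_kernel)
  have F_f: "fourier_transform (f \<alpha> t) \<zeta> =
      complex_of_real (indicator {0<..} t * (exp (- (lam + 4 * pi\<^sup>2 * (norm \<zeta>)\<^sup>2) * t) * t powr (\<alpha> - 1)))" for \<alpha> t \<zeta>
  proof (cases "t > 0")
    case True
    have "fourier_transform (f \<alpha> t) \<zeta> = complex_of_real (exp (- lam * t) * t powr (\<alpha> - 1)) * fourier_transform (heat_kernel t) \<zeta>"
      using True unfolding fourier_transform_def f_def
      by (subst integral_mult_right_zero[symmetric]) (simp add: mult_ac)
    then show ?thesis
      using True by (simp add: fourier_heat_kernel(2) algebra_simps flip: of_real_mult exp_add)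
  qed (auto simp: f_def fourier_transform_def)
  have int_f_x: "(LINT x|lborel. f \<alpha> t x) = indicator {0<..} t * (exp (- lam * t) * t powr (\<alpha> - 1))" for \<alpha> t
    using F_f[of \<alpha> t 0] unfolding fourier_transform_0 of_real_eq_iff by simp
  have f_m2: "(\<lambda>(t, x). f \<alpha> t x) \<in> borel_measurable (lborel \<Otimes>\<^sub>M lborel)" for \<alpha>
    unfolding f_def by measurable
  have int_ft: "integrable lborel (\<lambda>t. LINT x|lborel. f \<alpha> t x)" if "\<alpha> > 0" for \<alpha>
    unfolding int_f_x using gamma_integral[of lam \<alpha>] l that by (auto intro: integrable.intros)
  note A = fourier_fubini[OF f_m2 f_nn int_f int_ft]
  have B: "fourier_transform (\<lambda>x. LINT t|lborel. f \<alpha> t x) \<zeta> =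
      complex_of_real (Gamma \<alpha> * (lam + 4 * pi\<^sup>2 * (norm \<zeta>)\<^sup>2) powr - \<alpha>)" if "\<alpha> > 0" for \<alpha> \<zeta>
    unfolding A(2)[OF that] F_f integral_complex_of_real
    using has_bochner_integral_integral_eq[OF gamma_integral[of "lam + 4 * pi\<^sup>2 * (norm \<zeta>)\<^sup>2" \<alpha>]] c[of \<zeta>] that by simp
  have G_m: "(\<lambda>(\<alpha>, x). G \<alpha> x) \<in> borel_measurable (lborel \<Otimes>\<^sub>M lborel)"
    unfolding G_def f_def by measurable
  have G_nn: "G \<alpha> x \<ge> 0" for \<alpha> x
    using s f_nn Gamma_real_pos[of \<alpha>]
    by (auto simp: G_def rGamma_inverse_Gamma indicator_def intro!: mult_nonneg_nonneg integral_nonneg_AE)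
  have int_G: "integrable lborel (G \<alpha>)" for \<alpha>
    using A(1)[of \<alpha>] s by (cases "\<alpha> \<ge> s") (auto simp: G_def intro!: integrable_mult_right)
  have F_G: "fourier_transform (G \<alpha>) \<zeta> =
      complex_of_real (indicator {s..} \<alpha> * (lam + 4 * pi\<^sup>2 * (norm \<zeta>)\<^sup>2) powr - \<alpha>)" for \<alpha> \<zeta>
  proof (cases "\<alpha> \<ge> s")
    case True
    then have \<alpha>: "\<alpha> > 0" using s by simp
    have "fourier_transform (G \<alpha>) \<zeta> = complex_of_real (rGamma \<alpha>) * fourier_transform (\<lambda>x. LINT t|lborel. f \<alpha> t x) \<zeta>"
      using True unfolding fourier_transform_def G_def
      by (subst integral_mult_right_zero[symmetric]) (simp add: mult_ac)
    then show ?thesis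
      using True Gamma_real_pos[OF \<alpha>] by (simp add: B[OF \<alpha>] rGamma_inverse_Gamma)
  qed (auto simp: G_def fourier_transform_def)
  have int_G_x: "(LINT x|lborel. G \<alpha> x) = indicator {s..} \<alpha> * lam powr - \<alpha>" for \<alpha>
    using F_G[of \<alpha> 0] unfolding fourier_transform_0 of_real_eq_iff by simp
  have int_G\<alpha>: "integrable lborel (\<lambda>\<alpha>. LINT x|lborel. G \<alpha> x)"
    unfolding int_G_x using powr_integral[OF l, of s] by (auto intro: integrable.intros)
  note C = fourier_fubini[OF G_m G_nn int_G int_G\<alpha>]
  show "integrable lborel (log_bessel_kernel s lam :: 'a \<Rightarrow> real)"
    unfolding K by (rule C(1))
  show "fourier_transform (log_bessel_kernel s lam) \<xi> =
         complex_of_real (1 / ((lam + 4 * pi\<^sup>2 * (norm \<xi>)\<^sup>2) powr s * ln (lam + 4 * pi\<^sup>2 * (norm \<xi>)\<^sup>2)))"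
    unfolding K C(2) F_G integral_complex_of_real
    using has_bochner_integral_integral_eq[OF powr_integral[OF c[of \<xi>], of s]]
    by (simp add: powr_minus field_simps)
qed

end

theory Submission
  imports Defs "HOL-Real_Asymp.Real_Asymp"
begin

text \<open>
  Interchanging the two integrals in the kernel turns it into
  \[ K(x) = (4\pi)^{-n/2} \int_0^\infty e^{-t} \nu(t)\; t^{-n/2} e^{-(\lambda-1)t - |x|^2/(4t)}\,dt,
     \qquad \nu(t) = \int_s^\infty \frac{t^{\alpha-1}}{\Gamma(\alpha)}\,d\alpha, \]
  (lemma \<open>log_bessel_kernel_eq_single_integral\<close>). The function $\nu$ is a continuous analogue of
  the exponential series, and indeed $e^{-t}\nu(t) \to 1$. As $|x|$ grows, the second factor of
  the integrand concentrates around $t = |x|/(2\sqrt{\lambda-1})$, which tends to infinity, so the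
  kernel behaves like the integral with $e^{-t}\nu(t)$ replaced by \<open>1\<close>, that is, like the Green
  function of $(\lambda - 1) - \Delta$.

  The growth of $\nu$ (theorem \<open>volterra_nu_asymptotics\<close>) comes from the regularized incomplete gamma
  function $P(\alpha,t) = \gamma(\alpha,t)/\Gamma(\alpha)$. Integration by parts gives
  $P(\alpha,t) - P(\alpha+1,t) = e^{-t} t^\alpha/\Gamma(\alpha+1)$, and integrating this over
  $\alpha \ge s$ telescopes to
  \[ e^{-t} \int_{s+1}^\infty \frac{t^{\alpha-1}}{\Gamma(\alpha)}\,d\alpha
     = \int_s^{s+1} P(\alpha,t)\,d\alpha . \]
  Here $0 \le P \le 1$ and $P(\alpha,t) \to 1$ as $t \to \infty$. The missing part of $\nu$, over
  $s \le \alpha < s+1$, contributes at most $(s+1)/t$ by the same relation. This also gives the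
  bound $e^{-t}\nu(t) \le 1 + (s+1)/t$ for all $t > 0$ that dominates the integrand near \<open>0\<close>.

  The second step (theorem \<open>Laplace_asymptotics\<close>) is Laplace's method. With $m = \sqrt{\lambda-1}$
  and $r = |x|$ the substitution $t = \frac{r}{2m} e^{w/\sqrt r}$ turns the exponent into
  $-mr\cosh(w/\sqrt r)$, and dominated convergence leaves the Gaussian integral
  $\int e^{-mw^2/2}\,dw = \sqrt{2\pi/m}$.
\<close>

section \<open>The Volterra function and its growth\<close>

text \<open>
  The regularized lower incomplete gamma function $P(\alpha,t) = \gamma(\alpha,t)/\Gamma(\alpha)$.
  Multiplying by the reciprocal gamma function, which is entire, instead of dividing makes
  measurability in \<open>\<alpha>\<close> immediate.
\<close>
definition reg_lower_gamma :: "real \<Rightarrow> real \<Rightarrow> real" where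
  "reg_lower_gamma \<alpha> t =
     rGamma \<alpha> * (LINT u|lborel. indicator {0<..t} u * (exp (- u) * u powr (\<alpha> - 1)))"

text \<open>
  This is Volterra's function $\nu(t, s-1)$. It is what remains of the kernel after the integration
  over \<open>\<alpha>\<close>, and it grows like $e^t$ because the integral over \<open>\<alpha>\<close> is a continuous
  analogue of the exponential series.
\<close>
definition volterra_nu :: "real \<Rightarrow> real \<Rightarrow> real" where
  "volterra_nu s t = (LINT \<alpha>|lborel. indicator {s..} \<alpha> * (rGamma \<alpha> * t powr (\<alpha> - 1)))"

lemma borel_measurable_rGamma [measurable]: "(rGamma :: real \<Rightarrow> real) \<in> borel_measurable borel"
  by (intro borel_measurable_continuous_onI continuous_on_rGamma)

lemma volterra_nu_measurable [measurable]: "volterra_nu s \<in> borel_measurable borel"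
  unfolding volterra_nu_def by measurable

lemma rGamma_pos: "rGamma \<alpha> > 0" if "\<alpha> > 0" for \<alpha> :: real
  using Gamma_real_pos[OF that] by (simp add: rGamma_inverse_Gamma)

lemma Gamma_kernel_integral:
  fixes \<alpha> :: real
  assumes "\<alpha> > 0"
  shows "has_bochner_integral lborel (\<lambda>u. indicator {0<..} u * (exp (- u) * u powr (\<alpha> - 1))) (Gamma \<alpha>)"
  using gamma_integral[of 1 \<alpha>] assms by simp

lemma lower_gamma_integrable:
  fixes \<alpha> :: real
  assumes "\<alpha> > 0"
  shows "integrable lborel (\<lambda>u. indicator {0<..t} u * (exp (- u) * u powr (\<alpha> - 1)))"
  by (rule Bochner_Integration.integrable_bound[OF integrable.intros[OF Gamma_kernel_integral[OF assms]]])
     (auto simp: indicator_def)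

lemma reg_lower_gamma_measurable [measurable]:
  "(\<lambda>\<alpha>. reg_lower_gamma \<alpha> t) \<in> borel_measurable borel"
  unfolding reg_lower_gamma_def by measurable

lemma reg_lower_gamma_nonneg: "reg_lower_gamma \<alpha> t \<ge> 0" if "\<alpha> > 0"
  unfolding reg_lower_gamma_def using rGamma_pos[OF that]
  by (intro mult_nonneg_nonneg integral_nonneg_AE) auto

lemma reg_lower_gamma_le_1:
  fixes \<alpha> :: real
  assumes "\<alpha> > 0"
  shows "reg_lower_gamma \<alpha> t \<le> 1"
proof -
  note G = Gamma_kernel_integral[OF assms]
  have "(LINT u|lborel. indicator {0<..t} u * (exp (- u) * u powr (\<alpha> - 1))) \<le> Gamma \<alpha>"
    unfolding has_bochner_integral_integral_eq[OF G, symmetric]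
    by (intro integral_mono lower_gamma_integrable[OF assms] integrable.intros[OF G])
       (auto simp: indicator_def)
  then have "reg_lower_gamma \<alpha> t \<le> rGamma \<alpha> * Gamma \<alpha>"
    unfolding reg_lower_gamma_def using rGamma_pos[OF assms] by (intro mult_left_mono) auto
  also have "\<dots> = 1"
    using Gamma_real_pos[OF assms] by (simp add: rGamma_inverse_Gamma)
  finally show ?thesis .
qed

lemma reg_lower_gamma_tendsto_1:
  fixes \<alpha> :: real
  assumes "\<alpha> > 0"
  shows "((\<lambda>t. reg_lower_gamma \<alpha> t) \<longlongrightarrow> 1) at_top"
proof -
  note G = Gamma_kernel_integral[OF assms]
  have "((\<lambda>t. rGamma \<alpha> * (LINT u|lborel. indicator {..t} u *\<^sub>R
           (indicator {0<..} u * (exp (- u) * u powr (\<alpha> - 1))))) \<longlongrightarrow> rGamma \<alpha> * Gamma \<alpha>) at_top"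
    unfolding has_bochner_integral_integral_eq[OF G, symmetric]
    by (intro tendsto_mult_left tendsto_integral_at_top integrable.intros[OF G]) auto
  also have "rGamma \<alpha> * Gamma \<alpha> = 1"
    using Gamma_real_pos[OF assms] by (simp add: rGamma_inverse_Gamma)
  also have "(\<lambda>t. rGamma \<alpha> * (LINT u|lborel. indicator {..t} u *\<^sub>R
           (indicator {0<..} u * (exp (- u) * u powr (\<alpha> - 1))))) = reg_lower_gamma \<alpha>"
    unfolding reg_lower_gamma_def
    by (intro ext arg_cong2[where f = "(*)"] refl Bochner_Integration.integral_cong)
       (auto simp: indicator_def)
  finally show ?thesis .
qed

text \<open>
  Integration by parts. This step relation drives everything below: the integrand of
  \<^const>\<open>volterra_nu\<close> at \<open>\<alpha> + 1\<close>, multiplied by $e^{-t}$, is a difference of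
  values of $P$ at distance one, so that its integral over \<open>\<alpha>\<close> telescopes.
\<close>
lemma reg_lower_gamma_rec:
  fixes \<alpha> t :: real
  assumes a: "\<alpha> > 0" and t: "t > 0"
  shows "reg_lower_gamma \<alpha> t - reg_lower_gamma (\<alpha> + 1) t = exp (- t) * (rGamma (\<alpha> + 1) * t powr \<alpha>)"
proof -
  let ?f = "\<lambda>b u. exp (- u) * u powr (b - 1) :: real"
  have hk: "(?f b has_integral (LINT u|lborel. indicator {0<..t} u * ?f b u)) {0<..t}" if "b > 0" for b
  proof -
    have "set_integrable lborel {0<..t} (?f b)"
      unfolding set_integrable_def using lower_gamma_integrable[OF that, of t] by simp
    from set_borel_integral_eq_integral[OF this] show ?thesis
      unfolding set_lebesgue_integral_def by (auto simp: has_integral_iff)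
  qed
  have hk0: "(?f b has_integral (LINT u|lborel. indicator {0<..t} u * ?f b u)) {0..t}" if "b > 0" for b
    by (rule has_integral_spike_set_eq[THEN iffD1, OF _ _ hk[OF that]])
       (auto intro: negligible_subset[of "{0}"])
  have "((\<lambda>u. \<alpha> * ?f \<alpha> u - ?f (\<alpha> + 1) u) has_integral
          (exp (- t) * t powr \<alpha> - exp (- 0) * 0 powr \<alpha>)) {0..t}"
  proof (rule fundamental_theorem_of_calculus_interior)
    show "continuous_on {0..t} (\<lambda>u. exp (- u) * u powr \<alpha>)"
      using a by (intro continuous_on_mult continuous_on_powr') (auto intro!: continuous_intros)
    show "((\<lambda>u. exp (- u) * u powr \<alpha>) has_vector_derivative \<alpha> * ?f \<alpha> u - ?f (\<alpha> + 1) u) (at u)"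
      if "u \<in> {0<..<t}" for u
      unfolding has_real_derivative_iff_has_vector_derivative[symmetric]
      using that by (auto intro!: derivative_eq_intros simp: algebra_simps powr_diff)
  qed (use t in auto)
  moreover have "((\<lambda>u. \<alpha> * ?f \<alpha> u - ?f (\<alpha> + 1) u) has_integral
      (\<alpha> * (LINT u|lborel. indicator {0<..t} u * ?f \<alpha> u) -
        (LINT u|lborel. indicator {0<..t} u * ?f (\<alpha> + 1) u))) {0..t}"
    using a by (intro has_integral_diff has_integral_mult_right hk0) auto
  ultimately have "\<alpha> * (LINT u|lborel. indicator {0<..t} u * ?f \<alpha> u) -
      (LINT u|lborel. indicator {0<..t} u * ?f (\<alpha> + 1) u) = exp (- t) * t powr \<alpha>"
    using a by (auto dest: has_integral_unique)
  moreover have "\<alpha> * rGamma (\<alpha> + 1) = rGamma \<alpha>"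
    using a by (simp add: rGamma_plus1)
  moreover have "g * I - g' * I' = e * (g' * p)" if "\<alpha> * I - I' = e * p" "\<alpha> * g' = g"
    for g g' I I' e p :: real
    using that by algebra
  ultimately show ?thesis
    unfolding reg_lower_gamma_def by (simp only: add_diff_cancel_right')
qed

text \<open>
  The gamma integral is bounded below by its part over the interval from \<open>M\<close> to \<open>M + 1\<close>.
  As \<open>M\<close> is free, this shows that the gamma function outgrows every exponential, which is all
  that is needed for the integrals over \<open>\<alpha>\<close> to converge.
\<close>
lemma Gamma_ge_powr:
  fixes \<alpha> M :: real
  assumes "\<alpha> \<ge> 1" and "M > 0"
  shows "exp (- (M + 1)) * M powr (\<alpha> - 1) \<le> Gamma \<alpha>"
proof -
  have a: "\<alpha> > 0" using assms by simp
  note G = Gamma_kernel_integral[OF a]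
  have "exp (- (M + 1)) * M powr (\<alpha> - 1) =
      (LINT u|lborel. indicator {M..M + 1} u * (exp (- (M + 1)) * M powr (\<alpha> - 1)))"
    by simp
  also have "\<dots> \<le> Gamma \<alpha>"
    unfolding has_bochner_integral_integral_eq[OF G, symmetric]
  proof (intro integral_mono integrable.intros[OF G])
    show "integrable lborel (\<lambda>u. indicator {M..M + 1} u * (exp (- (M + 1)) * M powr (\<alpha> - 1)))"
      by (intro integrable_mult_left integrable_real_indicator) auto
  qed (use assms in \<open>auto simp: indicator_def intro!: mult_mono powr_mono2\<close>)
  finally show ?thesis .
qed

lemma rGamma_powr_le:
  fixes \<alpha> t :: real
  assumes "\<alpha> > 0" and t: "t > 0"
  shows "rGamma \<alpha> * t powr (\<alpha> - 1) \<le> exp (exp 2 * t + 1) / t * exp 1 powr (- \<alpha>)"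
proof -
  \<comment> \<open>The base \<open>exp 2 * t\<close> leaves two factors \<open>exp (- \<alpha>)\<close>: one absorbs
    the factor \<open>\<alpha>\<close> that comes from \<open>\<Gamma>(\<alpha> + 1) = \<alpha> \<Gamma>(\<alpha>)\<close>, the other
    makes the bound integrable.\<close>
  define M where "M = exp 2 * t"
  have M: "M > 0" using t by (simp add: M_def)
  have G: "Gamma (\<alpha> + 1) > 0" using assms by simp
  have eq: "exp 1 powr (-\<alpha>) * (exp 1 powr (-\<alpha>) * exp 2 powr \<alpha>) = (1::real)"
    by (simp add: powr_def flip: exp_add)
  have "t powr \<alpha> = exp 1 powr (-\<alpha>) * exp 1 powr (-\<alpha>) * M powr \<alpha>"
    using t eq by (simp add: M_def powr_mult)
  also have "\<dots> \<le> exp 1 powr (-\<alpha>) * exp 1 powr (-\<alpha>) * (exp (M + 1) * Gamma (\<alpha> + 1))"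
  proof (rule mult_left_mono)
    have "exp (M + 1) * (exp (- (M + 1)) * M powr \<alpha>) \<le> exp (M + 1) * Gamma (\<alpha> + 1)"
      using Gamma_ge_powr[of "\<alpha> + 1" M] assms M by (intro mult_left_mono) auto
    then show "M powr \<alpha> \<le> exp (M + 1) * Gamma (\<alpha> + 1)"
      by (simp flip: mult.assoc exp_add)
  qed auto
  finally have "rGamma (\<alpha> + 1) * t powr \<alpha> \<le> exp 1 powr (-\<alpha>) * exp 1 powr (-\<alpha>) * exp (M + 1)"
    using G by (simp add: rGamma_inverse_Gamma field_simps)
  then have "\<alpha> / t * (rGamma (\<alpha> + 1) * t powr \<alpha>) \<le> \<alpha> / t * (exp 1 powr (-\<alpha>) * exp 1 powr (-\<alpha>) * exp (M + 1))"
    using assms by (intro mult_left_mono) auto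
  also have "\<dots> = (\<alpha> * exp 1 powr (-\<alpha>)) * (exp (M + 1) / t * exp 1 powr (-\<alpha>))"
    by simp
  also have "\<dots> \<le> 1 * (exp (M + 1) / t * exp 1 powr (-\<alpha>))"
  proof (rule mult_right_mono)
    have "\<alpha> \<le> exp \<alpha>" using exp_ge_add_one_self[of \<alpha>] by linarith
    then show "\<alpha> * exp 1 powr (-\<alpha>) \<le> 1"
      by (simp add: powr_def exp_minus field_simps)
  qed (use t in auto)
  finally have "\<alpha> / t * (rGamma (\<alpha> + 1) * t powr \<alpha>) \<le> exp (M + 1) / t * exp 1 powr (-\<alpha>)"
    by simp
  moreover have "rGamma \<alpha> = \<alpha> * rGamma (\<alpha> + 1)" using assms by (simp add: rGamma_plus1)
  ultimately show ?thesis
    using t by (simp add: powr_diff M_def)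
qed

lemma volterra_nu_integrable:
  fixes s t :: real
  assumes s: "s > 0" and t: "t > 0"
  shows "integrable lborel (\<lambda>\<alpha>. indicator {s..} \<alpha> * (rGamma \<alpha> * t powr (\<alpha> - 1)))"
proof (rule Bochner_Integration.integrable_bound)
  show "integrable lborel (\<lambda>\<alpha>. exp (exp 2 * t + 1) / t * (indicator {s..} \<alpha> * exp 1 powr - \<alpha>))"
    using powr_integral[of "exp 1" s] by (intro integrable_mult_right) (auto intro: integrable.intros)
  show "AE \<alpha> in lborel. norm (indicator {s..} \<alpha> * (rGamma \<alpha> * t powr (\<alpha> - 1)))
          \<le> norm (exp (exp 2 * t + 1) / t * (indicator {s..} \<alpha> * exp 1 powr - \<alpha>))"
    using rGamma_powr_le[of _ t] s t rGamma_pos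
    by (intro AE_I2) (auto simp: indicator_def less_imp_le)
qed auto

text \<open>
  For \<open>\<alpha> > 1\<close> the integrand $e^{-u} u^{\alpha-1}$ is at most $t^{\alpha-1}$ on the interval
  from \<open>0\<close> to \<open>t\<close>, which leads back to the integrand of \<^const>\<open>volterra_nu\<close>; for the
  remaining \<open>\<alpha>\<close> the bound \<open>1\<close> suffices.
\<close>
lemma reg_lower_gamma_integrable:
  fixes s t :: real
  assumes s: "s > 0" and t: "t > 0"
  shows "integrable lborel (\<lambda>\<alpha>. indicator {s..} \<alpha> * reg_lower_gamma \<alpha> t)"
proof (rule Bochner_Integration.integrable_bound)
  show "integrable lborel (\<lambda>\<alpha>. indicator {s..1} \<alpha> + t * (indicator {s..} \<alpha> * (rGamma \<alpha> * t powr (\<alpha> - 1))))"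
    using volterra_nu_integrable[OF s t]
    by (intro Bochner_Integration.integrable_add integrable_mult_right integrable_real_indicator)
       (auto simp: emeasure_lborel_Icc_eq)
  show "AE \<alpha> in lborel. norm (indicator {s..} \<alpha> * reg_lower_gamma \<alpha> t)
    \<le> norm (indicator {s..1} \<alpha> + t * (indicator {s..} \<alpha> * (rGamma \<alpha> * t powr (\<alpha> - 1))))"
  proof (rule AE_I2)
    fix \<alpha> :: real
    consider "\<alpha> < s" | "s \<le> \<alpha>" "\<alpha> \<le> 1" | "s \<le> \<alpha>" "1 < \<alpha>" by linarith
    then show "norm (indicator {s..} \<alpha> * reg_lower_gamma \<alpha> t)
      \<le> norm (indicator {s..1} \<alpha> + t * (indicator {s..} \<alpha> * (rGamma \<alpha> * t powr (\<alpha> - 1))))"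
    proof cases
      case 2
      then have "\<alpha> > 0" using s by simp
      then have "reg_lower_gamma \<alpha> t \<le> 1" "reg_lower_gamma \<alpha> t \<ge> 0" "t * (rGamma \<alpha> * t powr (\<alpha> - 1)) \<ge> 0"
        using reg_lower_gamma_le_1 reg_lower_gamma_nonneg t rGamma_pos[of \<alpha>] by auto
      then show ?thesis using 2 by simp
    next
      case 3
      then have a: "\<alpha> > 0" by simp
      have "(LINT u|lborel. indicator {0<..t} u * (exp (- u) * u powr (\<alpha> - 1)))
         \<le> (LINT u|lborel. indicator {0<..t} u * t powr (\<alpha> - 1))"
      proof (intro integral_mono lower_gamma_integrable a)
        show "integrable lborel (\<lambda>u. indicator {0<..t} u * t powr (\<alpha> - 1))"
          using t by (intro integrable_mult_left integrable_real_indicator) auto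
        show "indicator {0<..t} u * (exp (- u) * u powr (\<alpha> - 1)) \<le> indicator {0<..t} u * t powr (\<alpha> - 1)"
          for u
        proof (cases "u \<in> {0<..t}")
          case True
          then have "exp (- u) * u powr (\<alpha> - 1) \<le> 1 * t powr (\<alpha> - 1)"
            using 3 by (intro mult_mono powr_mono2) auto
          then show ?thesis using True by simp
        qed auto
      qed
      also have "\<dots> = t * t powr (\<alpha> - 1)"
        using t by simp
      finally have "reg_lower_gamma \<alpha> t \<le> rGamma \<alpha> * (t * t powr (\<alpha> - 1))"
        unfolding reg_lower_gamma_def using rGamma_pos[OF a] by (intro mult_left_mono) auto
      then show ?thesis
        using 3 reg_lower_gamma_nonneg[OF a, of t] by (simp add: mult_ac)
    qed auto
  qed
qed auto

text \<open>
  The telescoping: integrating $P(\alpha,t) - P(\alpha+1,t)$ over all \<open>\<alpha> \<ge> s\<close> leaves the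
  integral of $P$ over a window of length one. The left-hand side is thereby an average of
  numbers between \<open>0\<close> and \<open>1\<close> that tend to \<open>1\<close>.
\<close>
lemma exp_times_volterra_nu:
  fixes s t :: real
  assumes s: "s > 0" and t: "t > 0"
  shows "exp (- t) * volterra_nu (s + 1) t = (LINT \<alpha>|lborel. indicator {s..<s + 1} \<alpha> * reg_lower_gamma \<alpha> t)"
proof -
  define P where "P = (\<lambda>\<alpha>. reg_lower_gamma \<alpha> t)"
  have int: "integrable lborel (\<lambda>\<alpha>. indicator {r..} \<alpha> * P \<alpha>)" if "r > 0" for r
    unfolding P_def using that t by (rule reg_lower_gamma_integrable)
  have i1: "integrable lborel (\<lambda>\<alpha>. indicator {s + 1..} \<alpha> * P \<alpha>)" 
    using int[of "s + 1"] s by simp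
  have shift: "indicator {s + 1..} (1 + 1 * \<alpha>) = (indicator {s..} \<alpha> :: real)" for \<alpha>
    by (auto simp: indicator_def)
  have i2: "integrable lborel (\<lambda>\<alpha>. indicator {s..} \<alpha> * P (\<alpha> + 1))"
    using lborel_integrable_real_affine[OF i1, of 1 1] unfolding shift by (simp add: add.commute)
  have "exp (- t) * volterra_nu (s + 1) t =
      exp (- t) * (LINT \<alpha>|lborel. indicator {s..} \<alpha> * (rGamma (\<alpha> + 1) * t powr \<alpha>))"
    unfolding volterra_nu_def
    by (subst lborel_integral_real_affine[of 1 _ 1]) (simp_all only: shift, simp_all add: add.commute)
  also have "\<dots> = (LINT \<alpha>|lborel. indicator {s..} \<alpha> * P \<alpha> - indicator {s..} \<alpha> * P (\<alpha> + 1))"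
    unfolding integral_mult_right_zero[symmetric]
    using reg_lower_gamma_rec[OF _ t] s
    by (intro Bochner_Integration.integral_cong) (auto simp: P_def indicator_def)
  also have "\<dots> = (LINT \<alpha>|lborel. indicator {s..} \<alpha> * P \<alpha>) - (LINT \<alpha>|lborel. indicator {s..} \<alpha> * P (\<alpha> + 1))"
    using int[OF s] i2 by (rule Bochner_Integration.integral_diff)
  also have "(LINT \<alpha>|lborel. indicator {s..} \<alpha> * P (\<alpha> + 1)) = (LINT \<alpha>|lborel. indicator {s + 1..} \<alpha> * P \<alpha>)"
    using lborel_integral_real_affine[of 1 "\<lambda>\<alpha>. indicator {s + 1..} \<alpha> * P \<alpha>" 1]
    unfolding shift by (simp add: add.commute)
  also have "(LINT \<alpha>|lborel. indicator {s..} \<alpha> * P \<alpha>) - \<dots> =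
      (LINT \<alpha>|lborel. indicator {s..} \<alpha> * P \<alpha> - indicator {s + 1..} \<alpha> * P \<alpha>)"
    using int[OF s] i1 by (rule Bochner_Integration.integral_diff[symmetric])
  also have "\<dots> = (LINT \<alpha>|lborel. indicator {s..<s + 1} \<alpha> * P \<alpha>)"
    by (intro Bochner_Integration.integral_cong) (auto simp: indicator_def)
  finally show ?thesis by (simp add: P_def)
qed

lemma reg_lower_gamma_window_integrable:
  fixes s t :: real
  assumes "s > 0" "t > 0"
  shows "integrable lborel (\<lambda>\<alpha>. indicator {s..<s + 1} \<alpha> * reg_lower_gamma \<alpha> t)"
  by (rule Bochner_Integration.integrable_bound[OF reg_lower_gamma_integrable[OF assms]])
     (auto simp: indicator_def)

text \<open>
  The previous identity only reaches indices above \<open>1\<close>, whereas small \<open>s > 0\<close> are needed as well.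
  Passing from \<open>s + 1\<close> back to \<open>s\<close> costs an integral over a window of length one, in which the
  step relation bounds $e^{-t}$ times the integrand by $\alpha/t$, since a difference of two values
  of $P$ is at most \<open>1\<close>.
\<close>
lemma volterra_nu_shift:
  fixes s t :: real
  assumes s: "s > 0" and t: "t > 0"
  shows "volterra_nu (s + 1) t \<le> volterra_nu s t" (is ?lower)
    and "exp (- t) * volterra_nu s t \<le> exp (- t) * volterra_nu (s + 1) t + (s + 1) / t" (is ?upper)
proof -
  have s1: "s + 1 > 0" using s by simp
  note i0 = volterra_nu_integrable[OF s t]
  note i1 = volterra_nu_integrable[OF s1 t]
  show ?lower
    unfolding volterra_nu_def using i0 i1 s
    by (intro integral_mono) (auto simp: indicator_def less_imp_le rGamma_pos)
  have bound: "exp (- t) * (rGamma \<alpha> * t powr (\<alpha> - 1)) \<le> (s + 1) / t" if "s \<le> \<alpha>" "\<alpha> < s + 1" for \<alpha>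
  proof -
    have a: "\<alpha> > 0" using that s by simp
    have "exp (- t) * (rGamma \<alpha> * t powr (\<alpha> - 1)) = \<alpha> / t * (exp (- t) * (rGamma (\<alpha> + 1) * t powr \<alpha>))"
      using t unfolding rGamma_plus1[of \<alpha>, symmetric] by (simp add: powr_diff)
    also have "\<dots> \<le> \<alpha> / t * 1"
      using a t reg_lower_gamma_rec[OF a t] reg_lower_gamma_le_1[OF a, of t] reg_lower_gamma_nonneg[of "\<alpha> + 1" t]
      by (intro mult_left_mono) auto
    also have "\<dots> \<le> (s + 1) / t"
      using that t by (auto simp: divide_right_mono)
    finally show ?thesis .
  qed
  have "exp (- t) * volterra_nu s t \<le> (LINT \<alpha>|lborel. exp (- t) * (indicator {s + 1..} \<alpha> * (rGamma \<alpha> * t powr (\<alpha> - 1)))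
            + indicator {s..<s + 1} \<alpha> * ((s + 1) / t))"
    unfolding volterra_nu_def integral_mult_right_zero[symmetric]
  proof (intro integral_mono)
    show "integrable lborel (\<lambda>\<alpha>. exp (- t) * (indicator {s + 1..} \<alpha> * (rGamma \<alpha> * t powr (\<alpha> - 1)))
            + indicator {s..<s + 1} \<alpha> * ((s + 1) / t))"
      using i1 by (intro Bochner_Integration.integrable_add integrable_mult_right integrable_mult_left integrable_real_indicator) auto
  qed (use i0 bound in \<open>auto simp: indicator_def\<close>)
  also have "\<dots> = exp (- t) * volterra_nu (s + 1) t + (s + 1) / t"
    unfolding volterra_nu_def using i1
    by (subst Bochner_Integration.integral_add) auto
  finally show ?upper .
qed

lemma exp_times_volterra_nu_bounds:
  fixes s t :: real
  assumes s: "s > 0" and t: "t > 0"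
  shows "0 \<le> exp (- t) * volterra_nu s t" and "exp (- t) * volterra_nu s t \<le> 1 + (s + 1) / t"
proof -
  show "0 \<le> exp (- t) * volterra_nu s t"
    unfolding volterra_nu_def using s
    by (intro mult_nonneg_nonneg integral_nonneg_AE) (auto simp: indicator_def less_imp_le rGamma_pos)
  have "(LINT \<alpha>|lborel. indicator {s..<s + 1} \<alpha> * reg_lower_gamma \<alpha> t) \<le> (LINT \<alpha>|lborel. indicator {s..<s + 1} \<alpha>)"
  proof (intro integral_mono reg_lower_gamma_window_integrable s t)
    show "integrable lborel (indicator {s..<s + 1} :: real \<Rightarrow> real)" by simp
  qed (use s in \<open>auto simp: indicator_def reg_lower_gamma_le_1\<close>)
  also have "\<dots> = 1" by simp
  finally show "exp (- t) * volterra_nu s t \<le> 1 + (s + 1) / t"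
    using volterra_nu_shift(2)[OF s t] exp_times_volterra_nu[OF s t] by linarith
qed

text \<open>
  Squeezed between the window average of $P$ and the same average plus $(s+1)/t$; the average
  tends to \<open>1\<close> by dominated convergence.
\<close>
theorem volterra_nu_asymptotics:
  fixes s :: real
  assumes s: "s > 0"
  shows "((\<lambda>t. exp (- t) * volterra_nu s t) \<longlongrightarrow> 1) at_top"
proof -
  have "((\<lambda>t. LINT \<alpha>|lborel. indicator {s..<s + 1} \<alpha> * reg_lower_gamma \<alpha> t) \<longlongrightarrow>
           (LINT \<alpha>|lborel. indicator {s..<s + 1} \<alpha>)) at_top"
  proof (rule integral_dominated_convergence_at_top)
    show "integrable lborel (indicator {s..<s + 1} :: real \<Rightarrow> real)" by simp
    show "AE \<alpha> in lborel. ((\<lambda>t. indicator {s..<s + 1} \<alpha> * reg_lower_gamma \<alpha> t) \<longlongrightarrow> indicator {s..<s + 1} \<alpha>) at_top"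
      using s by (intro AE_I2) (auto simp: indicator_def intro!: reg_lower_gamma_tendsto_1)
    show "\<forall>\<^sub>F t in at_top. AE \<alpha> in lborel. norm (indicator {s..<s + 1} \<alpha> * reg_lower_gamma \<alpha> t) \<le> indicator {s..<s + 1} \<alpha>"
      using s by (intro always_eventually allI AE_I2)
        (auto simp: indicator_def reg_lower_gamma_le_1 reg_lower_gamma_nonneg)
  qed auto
  then have A: "((\<lambda>t. LINT \<alpha>|lborel. indicator {s..<s + 1} \<alpha> * reg_lower_gamma \<alpha> t) \<longlongrightarrow> 1) at_top"
    by simp
  have "((\<lambda>t. (LINT \<alpha>|lborel. indicator {s..<s + 1} \<alpha> * reg_lower_gamma \<alpha> t) + (s + 1) / t) \<longlongrightarrow> 1 + 0) at_top"
    by (intro tendsto_add A real_tendsto_divide_at_top[OF tendsto_const] filterlim_ident)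
  then have B: "((\<lambda>t. (LINT \<alpha>|lborel. indicator {s..<s + 1} \<alpha> * reg_lower_gamma \<alpha> t) + (s + 1) / t) \<longlongrightarrow> 1) at_top"
    by simp
  show ?thesis
  proof (rule tendsto_sandwich[OF _ _ A B])
    show "\<forall>\<^sub>F t in at_top. (LINT \<alpha>|lborel. indicator {s..<s + 1} \<alpha> * reg_lower_gamma \<alpha> t) \<le> exp (- t) * volterra_nu s t"
      using eventually_gt_at_top[of 0]
    proof eventually_elim
      case (elim t)
      have "exp (- t) * volterra_nu (s + 1) t \<le> exp (- t) * volterra_nu s t"
        by (intro mult_left_mono volterra_nu_shift(1) s elim) auto
      then show ?case unfolding exp_times_volterra_nu[OF s elim] .
    qed
    show "\<forall>\<^sub>F t in at_top. exp (- t) * volterra_nu s t \<le>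
        (LINT \<alpha>|lborel. indicator {s..<s + 1} \<alpha> * reg_lower_gamma \<alpha> t) + (s + 1) / t"
      using eventually_gt_at_top[of 0]
    proof eventually_elim
      case (elim t)
      then show ?case using volterra_nu_shift(2)[OF s elim] exp_times_volterra_nu[OF s elim] by linarith
    qed
  qed
qed

section \<open>Laplace's method for the saddle point integral\<close>
lemma Gaussian_integral:
  fixes m :: real
  assumes m: "m > 0"
  shows "has_bochner_integral lborel (\<lambda>w. exp (- (m * w\<^sup>2 / 2))) (sqrt (2 * pi / m))"
proof -
  define \<sigma> where "\<sigma> = 1 / sqrt m"
  have sg: "\<sigma> > 0" "\<sigma>\<^sup>2 = 1 / m"
    using m by (auto simp: \<sigma>_def power_divide)
  have eq: "exp (- (m * w\<^sup>2 / 2)) = sqrt (2 * pi / m) * normal_density 0 \<sigma> w" for w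
    using m by (simp add: normal_density_def sg(2) mult.commute)
  have "has_bochner_integral lborel (\<lambda>w. sqrt (2 * pi / m) * normal_density 0 \<sigma> w) (sqrt (2 * pi / m) * 1)"
    using sg by (intro has_bochner_integral_mult_right) (simp add: has_bochner_integral_iff)
  then show ?thesis unfolding eq by simp
qed

text \<open>The dominating function for the limit below; completing the square reduces it to Gaussians.\<close>
lemma exp_abs_Gaussian_integrable:
  fixes k m :: real
  assumes m: "m > 0"
  shows "integrable lborel (\<lambda>w. exp (k * \<bar>w\<bar> - m * w\<^sup>2 / 2))"
proof -
  have shifted: "integrable lborel (\<lambda>w. exp (c * w - m * w\<^sup>2 / 2))" for c
  proof -
    have "c * w - m * w\<^sup>2 / 2 = c\<^sup>2 / (2 * m) + - (m * (- (c / m) + 1 * w)\<^sup>2 / 2)" for w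
      using m by (simp add: field_simps power2_eq_square)
    then have eq: "exp (c * w - m * w\<^sup>2 / 2) = exp (c\<^sup>2 / (2 * m)) * exp (- (m * (- (c / m) + 1 * w)\<^sup>2 / 2))" for w
      by (simp only: exp_add)
    show ?thesis
      unfolding eq
      by (intro integrable_mult_right
            lborel_integrable_real_affine[OF integrable.intros[OF Gaussian_integral[OF m]]]) auto
  qed
  have "integrable lborel (\<lambda>w. exp (k * w - m * w\<^sup>2 / 2) + exp (- k * w - m * w\<^sup>2 / 2))"
    by (intro Bochner_Integration.integrable_add shifted)
  then show ?thesis
  proof (rule Bochner_Integration.integrable_bound)
    have "exp (k * \<bar>w\<bar> - m * w\<^sup>2 / 2) \<le> exp (k * w - m * w\<^sup>2 / 2) + exp (- k * w - m * w\<^sup>2 / 2)" for w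
      by (cases "w \<ge> 0") (auto simp: add_increasing add_increasing2)
    then show "AE w in lborel. norm (exp (k * \<bar>w\<bar> - m * w\<^sup>2 / 2)) \<le>
        norm (exp (k * w - m * w\<^sup>2 / 2) + exp (- k * w - m * w\<^sup>2 / 2))"
      by (intro AE_I2) (auto intro: order_trans[OF _ abs_ge_self])
  qed auto
qed

lemma cosh_ge_quadratic: "1 + v\<^sup>2 / 2 \<le> cosh (v :: real)"
proof -
  have sinh_ge: "y \<le> sinh y" if "y \<ge> 0" for y :: real
  proof -
    have "sinh 0 - 0 \<le> sinh y - y"
    proof (rule DERIV_nonneg_imp_nondecreasing[OF that])
      fix z :: real
      show "\<exists>d. ((\<lambda>y. sinh y - y) has_real_derivative d) (at z) \<and> 0 \<le> d"
        by (rule exI[of _ "cosh z - 1"])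
           (auto intro!: derivative_eq_intros simp: cosh_real_ge_1)
    qed
    then show ?thesis by simp
  qed
  have "(\<bar>v\<bar> / 2)\<^sup>2 \<le> (sinh (\<bar>v\<bar> / 2))\<^sup>2"
    by (intro power_mono sinh_ge) auto
  moreover have "cosh (2 * (\<bar>v\<bar> / 2)) = 1 + 2 * (sinh (\<bar>v\<bar> / 2))\<^sup>2"
    unfolding cosh_double by (simp add: cosh_square_eq)
  moreover have "cosh (2 * (\<bar>v\<bar> / 2)) = cosh v"
    by (simp add: abs_if)
  ultimately show ?thesis
    by (simp add: power_divide)
qed

lemma scaled_cosh_tendsto:
  fixes m w :: real
  shows "((\<lambda>r. m * r * (cosh (w / sqrt r) - 1)) \<longlongrightarrow> m * w\<^sup>2 / 2) at_top"
proof -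
  have "((\<lambda>r. r * (cosh (u / sqrt r) - 1)) \<longlongrightarrow> u * u / 2) at_top" if "u > 0" for u :: real
    using that unfolding cosh_field_def by real_asymp
  from tendsto_mult_left[OF this[of "\<bar>w\<bar>"], of m] show ?thesis
    by (cases "w = 0"; cases "w > 0") (auto simp: power2_eq_square mult.assoc)
qed

text \<open>
  The substitution $t = \rho e^{cw}$ from the half-line to the whole line. Measurability of
  \<open>f\<close>, rather than continuity, is the natural hypothesis, because in the application \<open>f\<close> contains
  the parameter integral \<^const>\<open>volterra_nu\<close>.
\<close>
lemma exp_substitution:
  fixes f :: "real \<Rightarrow> real"
  assumes [measurable]: "f \<in> borel_measurable borel" and "\<rho> > 0" and "c > 0"
    and int: "integrable lborel (\<lambda>w. c * (\<rho> * exp (c * w)) * f (\<rho> * exp (c * w)))"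
  shows "has_bochner_integral lborel (\<lambda>t. indicator {0<..} t * f t)
           (LINT w|lborel. c * (\<rho> * exp (c * w)) * f (\<rho> * exp (c * w)))"
proof -
  let ?g = "\<lambda>w. \<rho> * exp (c * w)" and ?h = "\<lambda>w. c * (\<rho> * exp (c * w)) * f (\<rho> * exp (c * w))"
  have range: "range ?g = {0<..}"
  proof (intro equalityI subsetI)
    fix t :: real assume "t \<in> {0<..}"
    then have "t = ?g (ln (t / \<rho>) / c)" using assms by simp
    then show "t \<in> range ?g" by blast
  qed (use assms in auto)
  have abs: "\<bar>c * ?g w\<bar> = c * ?g w" for w using assms by simp
  have "f absolutely_integrable_on range ?g \<and> integral (range ?g) f = integral UNIV ?h"
  proof (subst has_absolute_integral_change_of_variables_1'[where g' = "\<lambda>w. c * ?g w", symmetric])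
    show "inj_on ?g UNIV" using assms by (auto intro!: inj_onI)
    show "(?g has_field_derivative c * ?g w) (at w within UNIV)" for w
      by (auto intro!: derivative_eq_intros)
    have "integrable lebesgue ?h" using int by (simp add: integrable_completion)
    then show "(\<lambda>w. \<bar>c * ?g w\<bar> * f (?g w)) absolutely_integrable_on UNIV \<and>
        integral UNIV (\<lambda>w. \<bar>c * ?g w\<bar> * f (?g w)) = integral UNIV ?h"
      unfolding abs by (simp add: set_integrable_def)
  qed auto
  then have 1: "set_integrable lebesgue {0<..} f" and 2: "integral {0<..} f = integral UNIV ?h"
    unfolding range by auto
  have 3: "set_integrable lborel {0<..} f"
    using 1 unfolding set_integrable_def by (subst (asm) integrable_completion) auto
  have "integral UNIV ?h = (LINT w|lborel. ?h w)"
    using int by (simp add: integral_lborel)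
  moreover have "integral {0<..} f = (LINT t|lborel. indicator {0<..} t * f t)"
    using set_borel_integral_eq_integral(2)[OF 3] by (simp add: set_lebesgue_integral_def)
  ultimately show ?thesis
    using 2 3 by (simp add: has_bochner_integral_iff set_integrable_def)
qed

text \<open>
  The integrand $h(t)\, t^{-a} e^{-m^2 t - r^2/(4t)}$ after the substitution
  $t = \frac{r}{2m} e^{w/\sqrt r}$, with the size of the integral factored out. The exponent has
  its maximum $-mr$ at $t = r/(2m)$ and becomes $-mr \cosh(w/\sqrt r)$, symmetric about the saddle
  point; the scale $1/\sqrt r$ makes the limit in \<open>r\<close> a Gaussian in \<open>w\<close>.
\<close>
definition laplace_integrand :: "(real \<Rightarrow> real) \<Rightarrow> real \<Rightarrow> real \<Rightarrow> real \<Rightarrow> real \<Rightarrow> real" where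
  "laplace_integrand h a m r w = h (r / (2 * m) * exp (w / sqrt r)) *
     exp ((1 - a) * (w / sqrt r)) * exp (- (m * r * (cosh (w / sqrt r) - 1)))"

text \<open>
  The quadratic lower bound for \<open>cosh\<close> supplies a Gaussian that does not depend on \<open>r\<close>, and
  everything else, including the possible singularity of \<open>h\<close> at \<open>0\<close>, grows at most
  exponentially in \<open>\<bar>w\<bar>\<close>. The bound holds for every \<open>r > 0\<close>, so that it yields
  integrability for fixed \<open>r\<close>; for large \<open>r\<close> it is uniform.
\<close>
lemma laplace_integrand_bound:
  assumes h: "\<And>t. t > 0 \<Longrightarrow> 0 \<le> h t \<and> h t \<le> 1 + C / t"
    and C: "C \<ge> 0" and m: "m > 0" and r: "r > 0"
  shows "\<bar>laplace_integrand h a m r w\<bar> \<le>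
           (1 + C * (2 * m / r)) * exp ((1 + \<bar>1 - a\<bar>) / sqrt r * \<bar>w\<bar> - m * w\<^sup>2 / 2)"
proof -
  define v where "v = w / sqrt r"
  define t where "t = r / (2 * m) * exp v"
  have t: "t > 0" using m r by (simp add: t_def)
  have "h t \<le> 1 + C / t" using h[OF t] by simp
  also have "\<dots> = 1 + C * (2 * m / r) * exp (- v)"
    using m r by (simp add: t_def exp_minus field_simps)
  also have "\<dots> \<le> exp \<bar>v\<bar> + C * (2 * m / r) * exp \<bar>v\<bar>"
    using C m r by (intro add_mono mult_left_mono) auto
  finally have 1: "h t \<le> (1 + C * (2 * m / r)) * exp \<bar>v\<bar>" by (simp add: algebra_simps)
  have "(1 - a) * v \<le> \<bar>1 - a\<bar> * \<bar>v\<bar>" by (metis abs_ge_self abs_mult)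
  then have 2: "exp ((1 - a) * v) \<le> exp (\<bar>1 - a\<bar> * \<bar>v\<bar>)" by simp
  have "r * v\<^sup>2 = w\<^sup>2"
    using r by (simp add: v_def power_divide)
  then have "m * w\<^sup>2 / 2 = m * r * (v\<^sup>2 / 2)"
    by simp
  also have "\<dots> \<le> m * r * (cosh v - 1)"
    using cosh_ge_quadratic[of v] m r by (intro mult_left_mono) auto
  finally have 3: "exp (- (m * r * (cosh v - 1))) \<le> exp (- (m * w\<^sup>2 / 2))"
    by (simp only: exp_le_cancel_iff neg_le_iff_le)
  have "\<bar>laplace_integrand h a m r w\<bar> = h t * exp ((1 - a) * v) * exp (- (m * r * (cosh v - 1)))"
    using h[OF t] by (simp add: laplace_integrand_def v_def t_def abs_mult)
  also have "\<dots> \<le> ((1 + C * (2 * m / r)) * exp \<bar>v\<bar>) * exp (\<bar>1 - a\<bar> * \<bar>v\<bar>) * exp (- (m * w\<^sup>2 / 2))"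
    using h[OF t] C m r by (intro mult_mono 1 2 3) auto
  also have "\<dots> = (1 + C * (2 * m / r)) * exp (\<bar>v\<bar> + \<bar>1 - a\<bar> * \<bar>v\<bar> + - (m * w\<^sup>2 / 2))"
    by (simp only: exp_add mult.assoc)
  also have "\<bar>v\<bar> + \<bar>1 - a\<bar> * \<bar>v\<bar> + - (m * w\<^sup>2 / 2) = (1 + \<bar>1 - a\<bar>) / sqrt r * \<bar>w\<bar> - m * w\<^sup>2 / 2"
    using r by (simp add: v_def field_simps)
  finally show ?thesis .
qed

lemma laplace_substitution:
  fixes h :: "real \<Rightarrow> real"
  assumes [measurable]: "h \<in> borel_measurable borel"
    and h: "\<And>t. t > 0 \<Longrightarrow> 0 \<le> h t \<and> h t \<le> 1 + C / t"
    and C: "C \<ge> 0" and m: "m > 0" and r: "r > 0"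
  shows "integrable lborel (laplace_integrand h a m r)"
    and "has_bochner_integral lborel
           (\<lambda>t. indicator {0<..} t * (h t * (t powr (- a) * exp (- (m\<^sup>2 * t) - r\<^sup>2 / (4 * t)))))
           ((r / (2 * m)) powr (1 - a) / sqrt r * exp (- (m * r)) * (LINT w|lborel. laplace_integrand h a m r w))"
proof -
  have meas [measurable]: "laplace_integrand h a m r \<in> borel_measurable borel"
    unfolding laplace_integrand_def cosh_def by measurable
  show int: "integrable lborel (laplace_integrand h a m r)"
  proof (rule Bochner_Integration.integrable_bound)
    show "integrable lborel (\<lambda>w. (1 + C * (2 * m / r)) * exp ((1 + \<bar>1 - a\<bar>) / sqrt r * \<bar>w\<bar> - m * w\<^sup>2 / 2))"
      by (intro integrable_mult_right exp_abs_Gaussian_integrable m)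
    show "AE w in lborel. norm (laplace_integrand h a m r w) \<le>
        norm ((1 + C * (2 * m / r)) * exp ((1 + \<bar>1 - a\<bar>) / sqrt r * \<bar>w\<bar> - m * w\<^sup>2 / 2))"
      using laplace_integrand_bound[OF h C m r] C m r by (intro AE_I2) (simp add: abs_mult)
  qed auto
  define \<rho> where "\<rho> = r / (2 * m)"
  define c where "c = 1 / sqrt r"
  define f where "f = (\<lambda>t. h t * (t powr (- a) * exp (- (m\<^sup>2 * t) - r\<^sup>2 / (4 * t))))"
  have pos: "\<rho> > 0" "c > 0" using m r by (auto simp: \<rho>_def c_def)
  have eq: "c * (\<rho> * exp (c * w)) * f (\<rho> * exp (c * w)) =
      (\<rho> powr (1 - a) * c * exp (- (m * r))) * laplace_integrand h a m r w" for w
  proof -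
    define v where "v = c * w"
    define t where "t = \<rho> * exp v"
    have t: "t > 0" using pos by (simp add: t_def)
    have "- (m\<^sup>2 * t) - r\<^sup>2 / (4 * t) = - (m * r) + - (m * r * (cosh v - 1))"
      using m r by (simp add: t_def \<rho>_def cosh_def exp_minus field_simps power2_eq_square)
    then have "exp (- (m\<^sup>2 * t) - r\<^sup>2 / (4 * t)) = exp (- (m * r)) * exp (- (m * r * (cosh v - 1)))"
      by (simp only: exp_add)
    moreover have "t * t powr (- a) = \<rho> powr (1 - a) * exp ((1 - a) * v)"
    proof -
      have "t * t powr (- a) = t powr (1 - a)"
        using t by (simp add: powr_diff powr_minus field_simps)
      also have "\<dots> = \<rho> powr (1 - a) * exp v powr (1 - a)"
        using pos by (simp add: t_def powr_mult)
      finally show ?thesis by (simp add: powr_def)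
    qed
    ultimately have "c * t * f t = c * h t * (\<rho> powr (1 - a) * exp ((1 - a) * v)) *
        (exp (- (m * r)) * exp (- (m * r * (cosh v - 1))))"
      unfolding f_def by simp
    moreover have "laplace_integrand h a m r w = h t * exp ((1 - a) * v) * exp (- (m * r * (cosh v - 1)))"
      by (simp add: laplace_integrand_def t_def v_def c_def \<rho>_def)
    ultimately have "c * t * f t = (\<rho> powr (1 - a) * c * exp (- (m * r))) * laplace_integrand h a m r w"
      by (simp add: mult_ac)
    then show ?thesis by (simp only: t_def v_def)
  qed
  have [measurable]: "f \<in> borel_measurable borel" unfolding f_def by measurable
  have "has_bochner_integral lborel (\<lambda>t. indicator {0<..} t * f t)
           (LINT w|lborel. c * (\<rho> * exp (c * w)) * f (\<rho> * exp (c * w)))"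
  proof (rule exp_substitution)
    show "integrable lborel (\<lambda>w. c * (\<rho> * exp (c * w)) * f (\<rho> * exp (c * w)))"
      unfolding eq using int by (intro integrable_mult_right)
  qed (use pos in auto)
  then show "has_bochner_integral lborel
           (\<lambda>t. indicator {0<..} t * (h t * (t powr (- a) * exp (- (m\<^sup>2 * t) - r\<^sup>2 / (4 * t)))))
           ((r / (2 * m)) powr (1 - a) / sqrt r * exp (- (m * r)) * (LINT w|lborel. laplace_integrand h a m r w))"
    unfolding eq by (simp add: f_def \<rho>_def c_def)
qed

text \<open>
  For \<open>h = 1\<close> this is the large-argument asymptotics of a modified Bessel function of the second
  kind. A factor \<open>h\<close> with limit \<open>1\<close> at infinity does not change it, because the saddle point
  $r/(2m)$ moves off to infinity with \<open>r\<close>.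
\<close>
theorem Laplace_asymptotics:
  fixes h :: "real \<Rightarrow> real"
  assumes [measurable]: "h \<in> borel_measurable borel"
    and h: "\<And>t. t > 0 \<Longrightarrow> 0 \<le> h t \<and> h t \<le> 1 + C / t"
    and lim: "(h \<longlongrightarrow> 1) at_top"
    and C: "C \<ge> 0" and m: "m > 0"
  shows "((\<lambda>r. r powr (a - 1 / 2) * exp (m * r) *
            (LINT t|lborel. indicator {0<..} t * (h t * (t powr (- a) * exp (- (m\<^sup>2 * t) - r\<^sup>2 / (4 * t))))))
          \<longlongrightarrow> (2 * m) powr (a - 1) * sqrt (2 * pi / m)) at_top"
proof -
  have "((\<lambda>r. LINT w|lborel. laplace_integrand h a m r w) \<longlongrightarrow> (LINT w|lborel. exp (- (m * w\<^sup>2 / 2)))) at_top"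
  proof (rule integral_dominated_convergence_at_top)
    show "integrable lborel (\<lambda>w. (1 + C) * exp ((1 + \<bar>1 - a\<bar>) * \<bar>w\<bar> - m * w\<^sup>2 / 2))"
      by (intro integrable_mult_right exp_abs_Gaussian_integrable m)
    show "\<forall>\<^sub>F r in at_top. AE w in lborel. norm (laplace_integrand h a m r w) \<le>
            (1 + C) * exp ((1 + \<bar>1 - a\<bar>) * \<bar>w\<bar> - m * w\<^sup>2 / 2)"
      \<comment> \<open>From here on the saddle point \<open>r / (2 * m)\<close> is at least \<open>1\<close>, and so is \<open>sqrt r\<close>.\<close>
      using eventually_ge_at_top[of "max 1 (2 * m)"]
    proof (eventually_elim, intro AE_I2)
      fix r w :: real
      assume elim: "max 1 (2 * m) \<le> r"
      then have r: "r > 0" "sqrt r \<ge> 1" "2 * m / r \<le> 1" by (auto simp: divide_le_eq)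
      have "norm (laplace_integrand h a m r w) \<le>
           (1 + C * (2 * m / r)) * exp ((1 + \<bar>1 - a\<bar>) / sqrt r * \<bar>w\<bar> - m * w\<^sup>2 / 2)"
        using laplace_integrand_bound[OF h C m r(1)] by simp
      also have "\<dots> \<le> (1 + C * 1) * exp ((1 + \<bar>1 - a\<bar>) / 1 * \<bar>w\<bar> - m * w\<^sup>2 / 2)"
      proof (rule mult_mono)
        show "1 + C * (2 * m / r) \<le> 1 + C * 1"
          using r C by (intro add_left_mono mult_left_mono)
        have "(1 + \<bar>1 - a\<bar>) / sqrt r * \<bar>w\<bar> \<le> (1 + \<bar>1 - a\<bar>) / 1 * \<bar>w\<bar>"
          using r by (intro mult_right_mono divide_left_mono) auto
        then show "exp ((1 + \<bar>1 - a\<bar>) / sqrt r * \<bar>w\<bar> - m * w\<^sup>2 / 2) \<le> exp ((1 + \<bar>1 - a\<bar>) / 1 * \<bar>w\<bar> - m * w\<^sup>2 / 2)"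
          by simp
      qed (use C in auto)
      finally show "norm (laplace_integrand h a m r w) \<le>
            (1 + C) * exp ((1 + \<bar>1 - a\<bar>) * \<bar>w\<bar> - m * w\<^sup>2 / 2)" by simp
    qed
    show "AE w in lborel. ((\<lambda>r. laplace_integrand h a m r w) \<longlongrightarrow> exp (- (m * w\<^sup>2 / 2))) at_top"
    proof (intro AE_I2)
      fix w :: real
      have v: "((\<lambda>r. w / sqrt r) \<longlongrightarrow> 0) at_top" by real_asymp
      have "filterlim (\<lambda>r. r / (2 * m) * exp (w / sqrt r)) at_top at_top"
        using m by real_asymp
      from filterlim_compose[OF lim this]
      have "((\<lambda>r. laplace_integrand h a m r w) \<longlongrightarrow> 1 * exp ((1 - a) * 0) * exp (- (m * w\<^sup>2 / 2))) at_top"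
        unfolding laplace_integrand_def by (intro tendsto_intros v scaled_cosh_tendsto)
      then show "((\<lambda>r. laplace_integrand h a m r w) \<longlongrightarrow> exp (- (m * w\<^sup>2 / 2))) at_top" by simp
    qed
  qed (auto simp: laplace_integrand_def cosh_def)
  then have "((\<lambda>r. (2 * m) powr (a - 1) * (LINT w|lborel. laplace_integrand h a m r w))
      \<longlongrightarrow> (2 * m) powr (a - 1) * sqrt (2 * pi / m)) at_top"
    unfolding has_bochner_integral_integral_eq[OF Gaussian_integral[OF m]] by (intro tendsto_mult_left)
  then show ?thesis
  proof (rule Lim_transform_eventually)
    show "\<forall>\<^sub>F r in at_top. (2 * m) powr (a - 1) * (LINT w|lborel. laplace_integrand h a m r w) =
      r powr (a - 1 / 2) * exp (m * r) *
            (LINT t|lborel. indicator {0<..} t * (h t * (t powr (- a) * exp (- (m\<^sup>2 * t) - r\<^sup>2 / (4 * t)))))"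
      using eventually_gt_at_top[of 0]
    proof eventually_elim
      case (elim r)
      let ?J = "LINT w|lborel. laplace_integrand h a m r w"
      have "r powr (a - 1 / 2) * r powr (1 - a) = r powr ((a - 1 / 2) + (1 - a))"
        by (simp only: powr_add)
      also have "(a - 1 / 2) + (1 - a) = 1 / 2"
        by simp
      finally have sqrt: "r powr (a - 1 / 2) * r powr (1 - a) = sqrt r"
        using elim by (simp add: powr_half_sqrt)
      have "(r / (2 * m)) powr (1 - a) = r powr (1 - a) / (2 * m) powr (1 - a)"
        by (rule powr_divide)
      also have "\<dots> = r powr (1 - a) * inverse ((2 * m) powr (1 - a))"
        by (rule divide_inverse)
      also have "inverse ((2 * m) powr (1 - a)) = (2 * m) powr (- (1 - a))"
        by (rule powr_minus[symmetric])
      also have "- (1 - a) = a - 1"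
        by simp
      finally have split: "(r / (2 * m)) powr (1 - a) = r powr (1 - a) * (2 * m) powr (a - 1)" .
      have "r powr (a - 1 / 2) * exp (m * r) *
          ((r / (2 * m)) powr (1 - a) / sqrt r * exp (- (m * r)) * ?J) =
          (r powr (a - 1 / 2) * r powr (1 - a)) / sqrt r * (2 * m) powr (a - 1) * (exp (m * r) * exp (- (m * r))) * ?J"
        unfolding split by (simp only: divide_inverse mult_ac)
      also have "exp (m * r) * exp (- (m * r)) = 1"
        by (simp flip: exp_add)
      also have "(r powr (a - 1 / 2) * r powr (1 - a)) / sqrt r = 1"
        using elim unfolding sqrt by simp
      also have "(r / (2 * m)) powr (1 - a) / sqrt r * exp (- (m * r)) * ?J =
          (LINT t|lborel. indicator {0<..} t * (h t * (t powr (- a) * exp (- (m\<^sup>2 * t) - r\<^sup>2 / (4 * t)))))"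
        by (intro has_bochner_integral_integral_eq[symmetric] laplace_substitution(2)[where C = C] assms elim)
      finally show ?case
        by (simp only: mult_1_left mult_1_right)
    qed
  qed
qed

section \<open>Asymptotics of the logarithmic Bessel kernel\<close>

text \<open>
  Fubini: all integrands are nonnegative, so integrating over \<open>\<alpha>\<close> first is justified once the
  resulting integral over \<open>t\<close> is known to converge, which is the integrability part of the
  substitution. Writing $e^{-\lambda t} = e^{-t} e^{-(\lambda-1)t}$ gives $e^{-t}$ to the Volterra
  function; this is why $\lambda - 1$ and not $\lambda$ appears in the decay rate.
\<close>
lemma log_bessel_kernel_eq_single_integral:
  fixes x :: "'a::euclidean_space"
  assumes s: "s > 0" and lam: "lam > 1" and x: "x \<noteq> 0"
  defines "a \<equiv> real DIM('a) / 2"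
  shows "log_bessel_kernel s lam x = (4 * pi) powr (- a) *
    (LINT t|lborel. indicator {0<..} t * ((exp (- t) * volterra_nu s t) *
       (t powr (- a) * exp (- ((sqrt (lam - 1))\<^sup>2 * t) - (norm x)\<^sup>2 / (4 * t)))))"
proof -
  define q where "q = (\<lambda>t \<alpha>. indicator {0<..} t * (exp (- lam * t) * heat_kernel t x) *
     (indicator {s..} \<alpha> * (rGamma \<alpha> * t powr (\<alpha> - 1))))"
  define H where "H = (\<lambda>t. indicator {0<..} t * ((exp (- t) * volterra_nu s t) *
       (t powr (- a) * exp (- ((sqrt (lam - 1))\<^sup>2 * t) - (norm x)\<^sup>2 / (4 * t)))))"
  have int_H: "integrable lborel H"
    unfolding H_def
  proof (rule integrable.intros[OF laplace_substitution(2)[where C = "s + 1"]])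
    show "0 \<le> exp (- t) * volterra_nu s t \<and> exp (- t) * volterra_nu s t \<le> 1 + (s + 1) / t" if "t > 0" for t
      using exp_times_volterra_nu_bounds[OF s that] by blast
  qed (use s lam x in auto)
  have weight: "exp (- lam * t) * heat_kernel t x =
      (4 * pi) powr (- a) * (exp (- t) * (t powr (- a) * exp (- ((sqrt (lam - 1))\<^sup>2 * t) - (norm x)\<^sup>2 / (4 * t))))"
    if "t > 0" for t
  proof -
    have "- lam * t + - (norm x)\<^sup>2 / (4 * t) = - t + (- ((sqrt (lam - 1))\<^sup>2 * t) - (norm x)\<^sup>2 / (4 * t))"
      using lam by (simp add: algebra_simps)
    then have "exp (- lam * t) * exp (- (norm x)\<^sup>2 / (4 * t)) =
        exp (- t) * exp (- ((sqrt (lam - 1))\<^sup>2 * t) - (norm x)\<^sup>2 / (4 * t))"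
      by (simp only: exp_add[symmetric])
    moreover have "(4 * pi * t) powr (- a) = (4 * pi) powr (- a) * t powr (- a)"
      using that by (simp add: powr_mult)
    ultimately show ?thesis
      unfolding heat_kernel_def a_def by (simp add: mult_ac)
  qed
  have inner: "(LINT \<alpha>|lborel. q t \<alpha>) = (4 * pi) powr (- a) * H t" for t
  proof (cases "t > 0")
    case True
    have "(LINT \<alpha>|lborel. q t \<alpha>) = indicator {0<..} t * (exp (- lam * t) * heat_kernel t x) * volterra_nu s t"
      unfolding q_def volterra_nu_def by (rule integral_mult_right_zero)
    then show ?thesis
      using True unfolding weight[OF True] H_def by (simp add: mult_ac)
  qed (auto simp: q_def H_def)
  have q_nonneg: "q t \<alpha> \<ge> 0" for t \<alpha>
    using s rGamma_pos[of \<alpha>] by (auto simp: q_def heat_kernel_def indicator_def)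
  have P: "pair_sigma_finite (lborel :: real measure) (lborel :: real measure)"
    by (intro pair_sigma_finite.intro sigma_finite_lborel)
  have "integrable (lborel \<Otimes>\<^sub>M lborel) (case_prod q)"
  proof (rule pair_sigma_finite.Fubini_integrable[OF P])
    show "case_prod q \<in> borel_measurable (lborel \<Otimes>\<^sub>M lborel)"
      unfolding q_def heat_kernel_def by measurable
    show "integrable lborel (\<lambda>t. LINT \<alpha>|lborel. norm (case_prod q (t, \<alpha>)))"
      using int_H by (simp add: q_nonneg inner)
    show "AE t in lborel. integrable lborel (\<lambda>\<alpha>. case_prod q (t, \<alpha>))"
    proof (rule AE_I2)
      fix t :: real
      show "integrable lborel (\<lambda>\<alpha>. case_prod q (t, \<alpha>))"
        using volterra_nu_integrable[OF s, of t] by (cases "t > 0") (auto simp: q_def)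
    qed
  qed
  note swap = pair_sigma_finite.Fubini_integral[OF P this]
  have "log_bessel_kernel s lam x = (LINT \<alpha>|lborel. LINT t|lborel. q t \<alpha>)"
    unfolding log_bessel_kernel_def set_lebesgue_integral_def
  proof (intro Bochner_Integration.integral_cong refl)
    fix \<alpha> :: real
    have "indicator {s..} \<alpha> *\<^sub>R (1 / Gamma \<alpha> * (LINT t|lborel. indicator {0<..} t *\<^sub>R (exp (- lam * t) * t powr (\<alpha> - 1) * heat_kernel t x)))
      = (LINT t|lborel. (indicator {s..} \<alpha> * rGamma \<alpha>) * (indicator {0<..} t * (exp (- lam * t) * t powr (\<alpha> - 1) * heat_kernel t x)))"
      unfolding integral_mult_right_zero by (simp add: rGamma_inverse_Gamma divide_inverse)
    also have "\<dots> = (LINT t|lborel. q t \<alpha>)"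
      by (intro Bochner_Integration.integral_cong refl) (simp add: q_def mult_ac)
    finally show "indicator {s..} \<alpha> *\<^sub>R (1 / Gamma \<alpha> * (LINT t|lborel. indicator {0<..} t *\<^sub>R (exp (- lam * t) * t powr (\<alpha> - 1) * heat_kernel t x)))
      = (LINT t|lborel. q t \<alpha>)" .
  qed
  also have "\<dots> = (LINT t|lborel. (4 * pi) powr (- a) * H t)"
    unfolding swap inner ..
  finally show ?thesis by (simp add: H_def)
qed

lemma limit_constant:
  fixes lam n :: real
  assumes lam: "lam > 1"
  defines "m \<equiv> sqrt (lam - 1)"
  shows "(4 * pi) powr (- (n / 2)) * ((2 * m) powr (n / 2 - 1) * sqrt (2 * pi / m)) =
    (lam - 1) powr ((n - 3) / 4) / (2 powr ((n + 1) / 2) * pi powr ((n - 1) / 2))"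
proof -
  have m: "m > 0" "lam - 1 = m\<^sup>2" using lam by (auto simp: m_def)
  have ln4: "ln (4::real) = 2 * ln 2"
    using ln_realpow[of 2 2] by simp
  have "(4 * pi) powr (- (n / 2)) * ((2 * m) powr (n / 2 - 1) * sqrt (2 * pi / m)) =
    exp (- (n / 2) * ln (4 * pi)) * (exp ((n / 2 - 1) * ln (2 * m)) * exp (1 / 2 * ln (2 * pi / m)))"
    using m by (simp add: powr_half_sqrt[symmetric] powr_def)
  also have "\<dots> = exp (- (n / 2) * ln (4 * pi) + ((n / 2 - 1) * ln (2 * m) + 1 / 2 * ln (2 * pi / m)))"
    by (simp only: exp_add)
  also have "- (n / 2) * ln (4 * pi) + ((n / 2 - 1) * ln (2 * m) + 1 / 2 * ln (2 * pi / m))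
    = (n - 3) / 4 * (2 * ln m) - ((n + 1) / 2 * ln 2 + (n - 1) / 2 * ln pi)"
    using m by (simp add: ln_mult ln_div ln4 field_simps)
  also have "exp \<dots> = (lam - 1) powr ((n - 3) / 4) / (2 powr ((n + 1) / 2) * pi powr ((n - 1) / 2))"
    using m by (simp add: powr_def ln_realpow exp_add exp_diff)
  finally show ?thesis .
qed

theorem proposition1p4:
  fixes s lam :: real
  assumes "s > 0" and "lam > 1"
  shows "((\<lambda>x :: real ^ 'n.
            (norm x powr ((real CARD('n) - 1) / 2) * exp (sqrt (lam - 1) * norm x)) *
              log_bessel_kernel s lam x)
          \<longlongrightarrow> (lam - 1) powr ((real CARD('n) - 3) / 4) /
                (2 powr ((real CARD('n) + 1) / 2) * pi powr ((real CARD('n) - 1) / 2)))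
         at_infinity"
proof -
  define n where "n = real CARD('n)"
  define m where "m = sqrt (lam - 1)"
  define L where "L = (\<lambda>r. r powr (n / 2 - 1 / 2) * exp (m * r) *
    (LINT t|lborel. indicator {0<..} t * ((exp (- t) * volterra_nu s t) *
       (t powr (- (n / 2)) * exp (- (m\<^sup>2 * t) - r\<^sup>2 / (4 * t))))))"
  have "(L \<longlongrightarrow> (2 * m) powr (n / 2 - 1) * sqrt (2 * pi / m)) at_top"
    unfolding L_def
  proof (rule Laplace_asymptotics[where C = "s + 1"])
    show "0 \<le> exp (- t) * volterra_nu s t \<and> exp (- t) * volterra_nu s t \<le> 1 + (s + 1) / t" if "t > 0" for t
      using exp_times_volterra_nu_bounds[OF assms(1) that] by blast
  qed (use assms volterra_nu_asymptotics in \<open>auto simp: m_def\<close>)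
  from tendsto_mult_left[OF filterlim_compose[OF this filterlim_norm_at_top], of "(4 * pi) powr (- (n / 2))"]
  have "((\<lambda>x :: real ^ 'n. (4 * pi) powr (- (n / 2)) * L (norm x)) \<longlongrightarrow>
      (lam - 1) powr ((n - 3) / 4) / (2 powr ((n + 1) / 2) * pi powr ((n - 1) / 2))) at_infinity"
    unfolding limit_constant[OF assms(2), of n, folded m_def, symmetric] .
  then have "((\<lambda>x :: real ^ 'n. (norm x powr ((n - 1) / 2) * exp (m * norm x)) * log_bessel_kernel s lam x)
      \<longlongrightarrow> (lam - 1) powr ((n - 3) / 4) / (2 powr ((n + 1) / 2) * pi powr ((n - 1) / 2))) at_infinity"
  proof (rule Lim_transform_eventually)
    have "\<forall>\<^sub>F x :: real ^ 'n in at_infinity. x \<noteq> 0"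
      unfolding eventually_at_infinity by (intro exI[of _ 1]) auto
    then show "\<forall>\<^sub>F x :: real ^ 'n in at_infinity. (4 * pi) powr (- (n / 2)) * L (norm x) =
      (norm x powr ((n - 1) / 2) * exp (m * norm x)) * log_bessel_kernel s lam x"
    proof eventually_elim
      case (elim x)
      then show ?case
        using log_bessel_kernel_eq_single_integral[OF assms elim]
        by (simp add: L_def n_def m_def diff_divide_distrib mult_ac)
    qed
  qed
  then show ?thesis by (simp add: n_def m_def)
qed

end
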